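(* Let $0<\varepsilon<1/100$. The sets $A_\varepsilon$ and $\mathcal{A}_\varepsilon$ in $\mathbb{R}^2$ both satisfy property (iv) for $j=1$.
   Context: Property (iv) (the fine weak $j$-dimensional approximation property with local $\rho_y$-uniformity) for a set $A\subset\mathbb{R}^n$: for every $\delta>0$ and every $y\in A$ there is $\rho_y>0$ such that for all $\rho\in(0,\rho_y]$ and all $x\in B_{\rho_y}(y)$ there is a $j$-dimensional affine space $L_{x,\rho}$ with $B_\rho(x)\cap A\subset L_{x,\rho}^{\delta\rho}$, where $L^s:=\{x:|x-z|<s\text{ for some }z\in L\}$ and $B_\rho(x)$ is the open ball. Triangular caps: for a segment $S=[a,b]\subset\mathbb{R}^2$ and $h>0$, an $h$-triangular cap on $S$ is the closed solid isosceles triangle with base $S$ and third vertex (apex) $\frac{a+b}{2}+c$, where $|c|=h$ and $c\perp b-a$. If $S$ is an edge of a previously constructed cap $T$, the side is chosen so that the new cap is contained in $T$; on the initial segment $[(0,0),(1,0)]$ the apex has positive second coordinate. Construction of $A_\varepsilon$: Let $A_0=A_{0,1}=[(0,0),(1,0)]$. Given $A_n=\bigcup_{i=1}^{2^n}A_{n,i}$, a polygonal curve from $(0,0)$ to $(1,0)$ whose segments are numbered consecutively from $(0,0)$ to $(1,0)$, let $T_{n,i}$ be the $2^{1-n}\varepsilon$-triangular cap on $A_{n,i}$, let $A_{n+1,2i-1},A_{n+1,2i}$ be the two edges of $T_{n,i}$ other than its base $A_{n,i}$, and let $A_{n+1}=\bigcup_{k=1}^{2^{n+1}}A_{n+1,k}$.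 Define $A_\varepsilon:=\overline{\bigcup_{n=1}^\infty A_n}\setminus\bigcup_{n=1}^\infty A_n$. Construction of $\mathcal{A}_\varepsilon$: Let $a_{n,i}$ be the apex of $T_{n,i}$. Set $e_1=(0,0)$, $e_2=(1,0)$ and $e_{2+i+\sum_{j=0}^{n-1}2^j}=a_{n,i}$ for $n\ge0$, $1\le i\le 2^n$. Set $\rho_1=\frac14 2^{-7}(1+7\cdot16\varepsilon^2)^{1/2}$ and $\rho_i=4^{1-i}\rho_1$. Let $r_1=\rho_1$, $r_2=\rho_2$, and for $i\ge3$, with $n\ge0$ the unique integer such that $2+\sum_{j=0}^n2^j\le i\le 1+\sum_{j=0}^{n+1}2^j$, let $r_i=\min\{\rho_i,\tfrac12 d(e_i,A_{n-1}\cup A_{n-2})\}$, where sets $A_k$ with $k<0$ are omitted (so $r_i=\rho_i$ when $n=0$). Define $\mathcal{A}_\varepsilon:=A_\varepsilon\setminus\bigcup_{i=1}^\infty B_{r_i}(e_i)$, with $B_r(e)$ open balls. *)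

theory Defs
  imports "HOL-Analysis.Analysis"
begin

definition open_nbhd :: "(real^'n) set \<Rightarrow> real \<Rightarrow> (real^'n) set" where
  "open_nbhd L s = {x. \<exists>z\<in>L. norm (x - z) < s}"

text \<open>The fine weak \<open>j\<close>-dimensional approximation property with local
  \<open>\<rho>\<^sub>y\<close>-uniformity.\<close>

definition fine_weak_approx :: "nat \<Rightarrow> (real^'n) set \<Rightarrow> bool" where
  "fine_weak_approx j A \<longleftrightarrow>
     (\<forall>\<delta>>0. \<forall>y\<in>A. \<exists>\<rho>y>0. \<forall>\<rho>\<in>{0<..\<rho>y}. \<forall>x\<in>ball y \<rho>y.
        \<exists>L. affine L \<and> aff_dim L = int j \<and> ball x \<rho> \<inter> A \<subseteq> open_nbhd L (\<delta> * \<rho>))"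

definition cap_apex :: "real^2 \<Rightarrow> real^2 \<Rightarrow> real \<Rightarrow> real^2 \<Rightarrow> bool" where
  "cap_apex a b h p \<longleftrightarrow> (\<exists>c. norm c = h \<and> orthogonal c (b - a) \<and> p = midpoint a b + c)"

text \<open>\<open>cap_data \<epsilon> n i\<close> is the triple (start point of \<open>A\<^bsub>n,i\<^esub>\<close>, end point of \<open>A\<^bsub>n,i\<^esub>\<close>,
  apex of \<open>T\<^bsub>n,i\<^esub>\<close>), meaningful for \<open>1 \<le> i \<le> 2 ^ n\<close>. The parent of \<open>A\<^bsub>n+1,i\<^esub>\<close> has
  index \<open>(i + 1) div 2\<close>: odd \<open>i\<close> gives its first edge, even \<open>i\<close> its second. Of the two
  candidate apexes, exactly one gives a cap inside the parent cap when \<open>\<epsilon> > 0\<close>: the base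
  angles have tangent \<open>4 \<epsilon> / sqrt (1 + 16 n \<epsilon>\<^sup>2)\<close>, which decreases in \<open>n\<close>.\<close>

fun cap_data :: "real \<Rightarrow> nat \<Rightarrow> nat \<Rightarrow> (real^2) \<times> (real^2) \<times> (real^2)" where
  "cap_data \<epsilon> 0 i =
     (let a = vector [0, 0]; b = vector [1, 0]
      in (a, b, THE p. cap_apex a b (2 powi (1 - int 0) * \<epsilon>) p \<and> p $ 2 > 0))"
| "cap_data \<epsilon> (Suc n) i =
     (let (a, b, p) = cap_data \<epsilon> n ((i + 1) div 2);
          (a', b') = (if odd i then (a, p) else (p, b))
      in (a', b', THE q. cap_apex a' b' (2 powi (1 - int (Suc n)) * \<epsilon>) q \<and>
                         convex hull {a', b', q} \<subseteq> convex hull {a, b, p}))"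

definition seg :: "real \<Rightarrow> nat \<Rightarrow> nat \<Rightarrow> (real^2) set" where
  "seg \<epsilon> n i = (case cap_data \<epsilon> n i of (a, b, p) \<Rightarrow> closed_segment a b)"

definition apex :: "real \<Rightarrow> nat \<Rightarrow> nat \<Rightarrow> real^2" where
  "apex \<epsilon> n i = (case cap_data \<epsilon> n i of (a, b, p) \<Rightarrow> p)"

definition polygon_curve :: "real \<Rightarrow> nat \<Rightarrow> (real^2) set" where
  "polygon_curve \<epsilon> n = (\<Union>i\<in>{1..2 ^ n}. seg \<epsilon> n i)"

definition A_eps :: "real \<Rightarrow> (real^2) set" where
  "A_eps \<epsilon> = closure (\<Union>n\<in>{1..}. polygon_curve \<epsilon> n) - (\<Union>n\<in>{1..}. polygon_curve \<epsilon> n)"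

text \<open>The sequences \<open>e\<close>, \<open>\<rho>\<close> and \<open>r\<close> are indexed from 1; the value at 0 is irrelevant.\<close>

definition vertex_seq :: "real \<Rightarrow> nat \<Rightarrow> real^2" where
  "vertex_seq \<epsilon> k =
     (if k = 1 then vector [0, 0]
      else if k = 2 then vector [1, 0]
      else THE x. \<exists>n i. 1 \<le> i \<and> i \<le> 2 ^ n \<and> k = 2 + i + (\<Sum>j<n. 2 ^ j) \<and> x = apex \<epsilon> n i)"

definition rho_seq :: "real \<Rightarrow> nat \<Rightarrow> real" where
  "rho_seq \<epsilon> i = 4 powi (1 - int i) * (1 / 4 * 2 powi (-7) * sqrt (1 + 7 * 16 * \<epsilon>\<^sup>2))"

text \<open>The index set \<open>{k. k < n \<and> n \<le> k + 2}\<close> consists of those of \<open>n - 1\<close> and \<open>n - 2\<close> that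
  are nonnegative. The case \<open>n = 0\<close> is separate because \<open>infdist x {} = 0\<close>.\<close>

definition r_seq :: "real \<Rightarrow> nat \<Rightarrow> real" where
  "r_seq \<epsilon> i =
     (if i \<le> 2 then rho_seq \<epsilon> i
      else let n = (THE n. 2 + (\<Sum>j\<le>n. 2 ^ j) \<le> i \<and> i \<le> 1 + (\<Sum>j\<le>n + 1. 2 ^ j))
        in if n = 0 then rho_seq \<epsilon> i
           else min (rho_seq \<epsilon> i)
             (1 / 2 * infdist (vertex_seq \<epsilon> i) (\<Union>k\<in>{k. k < n \<and> n \<le> k + 2}. polygon_curve \<epsilon> k)))"

definition A_cal_eps :: "real \<Rightarrow> (real^2) set" where
  "A_cal_eps \<epsilon> = A_eps \<epsilon> - (\<Union>i\<in>{1..}. ball (vertex_seq \<epsilon> i) (r_seq \<epsilon> i))"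

end

theory Submission
  imports Defs "HOL-Real_Asymp.Real_Asymp"
begin

text \<open>The two children of a cap lie in opposite thin cones about the line through the common apex
  parallel to the base; the opening of the cones is proportional to the ratio of height to base of
  the cap, which tends to \<open>0\<close> with the level. As apexes do not belong to \<open>A\<^sub>\<epsilon>\<close>, each point
  of \<open>A\<^sub>\<epsilon>\<close> lies in exactly one cap of each level, so near \<open>y\<close> the set stays inside one
  arbitrarily flat cap. Given a small ball, take the last level at which one cap contains
  all points of the set in the ball: both children of that cap are met, so the apex is within
  distance about \<open>2\<rho>\<close> along the base direction and the cones give the line.\<close>

section \<open>Rotation and isosceles apexes in the plane\<close>

definition rot :: "real^2 \<Rightarrow> real^2" where
  "rot v = vector [- (v $ 2), v $ 1]"

lemma rot_nth [simp]: "rot v $ 1 = - (v $ 2)" "rot v $ 2 = v $ 1"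
  by (simp_all add: rot_def)

lemma inner_2: "inner x y = x $ 1 * y $ 1 + x $ 2 * y $ 2" for x y :: "real^2"
  by (simp add: inner_vec_def sum_2)

lemma norm_sq_2: "(norm x)\<^sup>2 = (x $ 1)\<^sup>2 + (x $ 2)\<^sup>2" for x :: "real^2"
  by (simp only: power2_norm_eq_inner inner_2) (simp add: power2_eq_square)

lemma norm_rot [simp]: "norm (rot v) = norm v"
  by (rule power2_eq_imp_eq) (auto simp: norm_sq_2)

lemma eq_2_iff: "x = y \<longleftrightarrow> x $ 1 = y $ 1 \<and> x $ 2 = y $ 2" for x y :: "real^2"
  by (simp add: vec_eq_iff forall_2)

lemma midpoint_nth [simp]: "midpoint a b $ i = (a $ i + b $ i) / 2" for a b :: "real^'n"
  by (simp add: midpoint_def)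

text \<open>The parameter \<open>s\<close> is the signed ratio of height to base length, positive to
  the left of the directed base. With a ratio in place of a height, coordinates are polynomial in
  \<open>a\<close>, \<open>b\<close>, \<open>s\<close>, and identities about apexes become plain
  algebra.\<close>

definition apx :: "real^2 \<Rightarrow> real^2 \<Rightarrow> real \<Rightarrow> real^2" where
  "apx a b s = midpoint a b + s *\<^sub>R rot (b - a)"

lemma apx_nth [simp]:
  "apx a b s $ 1 = (a $ 1 + b $ 1) / 2 - s * (b $ 2 - a $ 2)"
  "apx a b s $ 2 = (a $ 2 + b $ 2) / 2 + s * (b $ 1 - a $ 1)"
  by (simp_all add: apx_def right_diff_distrib')

text \<open>Reversing the base negates its rotation. This reduces claims about the second edge of a
  cap to claims about the first.\<close>

lemma apx_swap: "apx b a (- s) = apx a b s"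
  by (simp add: eq_2_iff algebra_simps)

text \<open>Pythagoras: the legs are half the base and |s| times the base.\<close>

lemma norm_apx_left: "norm (apx a b s - a) = sqrt (1 / 4 + s\<^sup>2) * norm (b - a)"
proof (rule power2_eq_imp_eq)
  show "(norm (apx a b s - a))\<^sup>2 = (sqrt (1 / 4 + s\<^sup>2) * norm (b - a))\<^sup>2"
    by (simp only: power_mult_distrib norm_sq_2)
       (simp add: power2_eq_square algebra_simps add_divide_distrib diff_divide_distrib)
qed auto

lemma norm_apx_right: "norm (b - apx a b s) = sqrt (1 / 4 + s\<^sup>2) * norm (b - a)"
  using norm_apx_left[of b a "- s"] by (simp add: apx_swap norm_minus_commute)

lemma orthogonal_2:
  fixes c v :: "real^2"
  assumes "orthogonal c v" "v \<noteq> 0"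
  obtains k where "c = k *\<^sub>R rot v"
proof
  have o: "c $ 1 * v $ 1 + c $ 2 * v $ 2 = 0"
    using assms(1) by (simp add: orthogonal_def inner_2)
  have n: "v $ 1 * v $ 1 + v $ 2 * v $ 2 \<noteq> 0"
    using assms(2) inner_eq_zero_iff[of v] by (simp add: inner_2)
  have "c $ 1 * (v $ 1 * v $ 1 + v $ 2 * v $ 2) = (c $ 2 * v $ 1 - c $ 1 * v $ 2) * - (v $ 2)"
       "c $ 2 * (v $ 1 * v $ 1 + v $ 2 * v $ 2) = (c $ 2 * v $ 1 - c $ 1 * v $ 2) * v $ 1"
    using o by algebra+
  \<comment> \<open>The coefficient is \<open>inner c (rot v)\<close> divided by the squared norm of
    \<open>v\<close>.\<close>
  then show "c = ((c $ 2 * v $ 1 - c $ 1 * v $ 2) / (v $ 1 * v $ 1 + v $ 2 * v $ 2)) *\<^sub>R rot v"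
    using n by (simp add: eq_2_iff field_simps)
qed

text \<open>In the plane the vectors orthogonal to the base are the multiples of its rotation, and
  the norm fixes the multiple up to sign. Evaluating the descriptions in \<open>cap_data\<close>
  thus amounts to choosing a sign.\<close>

lemma cap_apex_iff:
  assumes "a \<noteq> b" "s * norm (b - a) = h" "0 \<le> s"
  shows "cap_apex a b h p \<longleftrightarrow> p = apx a b s \<or> p = apx a b (- s)"
proof
  assume "cap_apex a b h p"
  then obtain c where c: "norm c = h" "orthogonal c (b - a)" "p = midpoint a b + c"
    by (auto simp: cap_apex_def)
  obtain k where k: "c = k *\<^sub>R rot (b - a)"
    using orthogonal_2[OF c(2)] assms(1) by auto
  have "\<bar>k\<bar> = s"
    using c(1) k assms by auto
  then show "p = apx a b s \<or> p = apx a b (- s)"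
    using c(3) k by (auto simp: apx_def abs_if split: if_splits)
next
  have "cap_apex a b h (apx a b r)" if "\<bar>r\<bar> = s" for r
    unfolding cap_apex_def apx_def
    using assms that by (intro exI[of _ "r *\<^sub>R rot (b - a)"])
      (auto simp: orthogonal_def inner_2 algebra_simps)
  then show "cap_apex a b h p" if "p = apx a b s \<or> p = apx a b (- s)"
    using that assms by auto
qed

section \<open>A cap and its two children\<close>

lemma hull_halfspace:
  fixes w :: "'a::real_inner"
  assumes "x \<in> convex hull {a, b, c}"
    and "inner w a \<le> k" "inner w b \<le> k" "inner w c \<le> k"
  shows "inner w x \<le> k"
proof -
  have "convex hull {a, b, c} \<subseteq> {x. inner w x \<le> k}"
    using assms by (intro hull_minimal convex_halfspace_le) auto
  then show ?thesis using assms(1) by auto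
qed

text \<open>The child apex has explicit barycentric weights, affine in \<open>g\<close>. Opposite
  signs and decreasing modulus of the slopes put \<open>g\<close> between 0 and 1, and the bound on
  \<open>s\<close> keeps the weight of \<open>a\<close> nonnegative.\<close>

lemma child_apex_in_hull:
  assumes "s * s' < 0" "\<bar>s'\<bar> \<le> \<bar>s\<bar>" "\<bar>s\<bar> \<le> 1 / 50"
  shows "apx a (apx a b s) s' \<in> convex hull {a, b, apx a b s}"
proof -
  define g where "g = - (s' / s)"
  have s: "s \<noteq> 0" and s': "s' = - g * s" using assms by (auto simp: g_def)
  have g: "0 \<le> g" "g \<le> 1"
    using assms s unfolding g_def
    by (auto simp: divide_simps abs_if mult_less_0_iff split: if_splits)
  have "\<bar>s\<bar>\<^sup>2 \<le> (1 / 50)\<^sup>2" using assms(3) by (intro power_mono) auto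
  then have "s\<^sup>2 \<le> 1 / 4" by (simp add: power_divide)
  then have "g * s\<^sup>2 \<le> 1 * (1 / 4)" using g by (intro mult_mono) auto
  then have "0 \<le> 1 / 2 + g / 4 - g * s\<^sup>2" "0 \<le> g * s\<^sup>2 + g / 4" "0 \<le> (1 - g) / 2"
    using g by auto
  moreover have "apx a (apx a b s) s' = (1 / 2 + g / 4 - g * s\<^sup>2) *\<^sub>R a
      + (g * s\<^sup>2 + g / 4) *\<^sub>R b + ((1 - g) / 2) *\<^sub>R apx a b s"
    unfolding s' by (simp add: eq_2_iff power2_eq_square field_simps)
  ultimately show ?thesis
    unfolding convex_hull_3
    by - (intro CollectI exI conjI, assumption+, simp add: field_simps)
qed

text \<open>The line through \<open>a\<close> and the parent apex separates: \<open>b\<close> lies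
  on one side of it, the candidate with the wrong sign strictly on the other.\<close>

lemma child_apex_notin_hull:
  assumes "s * s' < 0" "a \<noteq> b"
  shows "apx a (apx a b s) (- s') \<notin> convex hull {a, b, apx a b s}"
proof
  let ?p = "apx a b s"
  \<comment> \<open>Normal to the edge from \<open>a\<close> to \<open>?p\<close>; the factor
    \<open>- s'\<close> makes it point out of the parent.\<close>
  let ?w = "- s' *\<^sub>R rot (?p - a)"
  assume "apx a ?p (- s') \<in> convex hull {a, b, ?p}"
  then have "inner ?w (apx a ?p (- s')) \<le> inner ?w a"
  proof (rule hull_halfspace)
    have "inner ?w (?p - a) = 0"
      by (simp add: inner_2 algebra_simps del: apx_nth)
    then show "inner ?w ?p \<le> inner ?w a" by (simp only: inner_diff_right)
    have "inner ?w b - inner ?w a = (s * s') * (norm (b - a))\<^sup>2"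
      unfolding norm_sq_2 by (simp add: inner_2 power2_eq_square algebra_simps add_divide_distrib diff_divide_distrib)
    then show "inner ?w b \<le> inner ?w a"
      using assms(1) by (smt (verit) mult_nonneg_nonpos2 zero_le_power2)
  qed simp
  moreover have "inner ?w (apx a ?p (- s')) - inner ?w a = s'\<^sup>2 * (norm (?p - a))\<^sup>2"
    unfolding norm_sq_2 by (simp add: inner_2 power2_eq_square algebra_simps add_divide_distrib diff_divide_distrib)
  moreover have "0 < s'\<^sup>2 * (norm (?p - a))\<^sup>2"
  proof -
    have "0 < norm (?p - a)"
      unfolding norm_apx_left using assms(2) by (intro mult_pos_pos) (auto intro: add_pos_nonneg)
    then show ?thesis using assms(1) by (intro mult_pos_pos) auto
  qed
  ultimately show False by linarith
qed

text \<open>The cone is an intersection of two half-planes, so testing the vertices suffices.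
  Relative to the parent apex and in units of the base, \<open>a\<close> is at (-1/2, -s) and the
  child apex at (-(1/4 + s s'), -(s - s')/2). The opening 8|s| is enough because 1/4 + s s' is at
  least 1/8.\<close>

lemma child_cone:
  assumes "\<bar>s'\<bar> \<le> \<bar>s\<bar>" "\<bar>s\<bar> \<le> 1 / 50"
    and x: "x \<in> convex hull {a, apx a b s, apx a (apx a b s) s'}"
  shows "\<bar>inner (x - apx a b s) (rot (b - a))\<bar> \<le> - (8 * \<bar>s\<bar>) * inner (x - apx a b s) (b - a)"
proof -
  let ?p = "apx a b s" and ?q = "apx a (apx a b s) s'"
  define N where "N = (norm (b - a))\<^sup>2"
  have N: "0 \<le> N" by (simp add: N_def)
  have ss: "\<bar>s * s'\<bar> \<le> 1 / 8"
  proof -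
    have "\<bar>s\<bar> * \<bar>s'\<bar> \<le> (1 / 50) * (1 / 50)" using assms by (intro mult_mono) auto
    then show ?thesis by (simp add: abs_mult)
  qed
  \<comment> \<open>The two values of \<open>r\<close> give the two half-planes.\<close>
  have half: "inner (x - ?p) (r *\<^sub>R rot (b - a) + (8 * \<bar>s\<bar>) *\<^sub>R (b - a)) \<le> 0" if r: "\<bar>r\<bar> = 1" for r
  proof -
    let ?w = "r *\<^sub>R rot (b - a) + (8 * \<bar>s\<bar>) *\<^sub>R (b - a)"
    have "inner ?w x \<le> inner ?w ?p"
    proof (rule hull_halfspace[OF x])
      have "inner ?w a - inner ?w ?p = - (r * s + 4 * \<bar>s\<bar>) * N"
        unfolding N_def norm_sq_2 by (simp add: inner_2 power2_eq_square algebra_simps add_divide_distrib diff_divide_distrib)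
      moreover have "0 \<le> r * s + 4 * \<bar>s\<bar>" using r by (auto simp: abs_if split: if_splits)
      ultimately show "inner ?w a \<le> inner ?w ?p"
        using N by (smt (verit) mult_minus_left mult_nonneg_nonneg)
      have "inner ?w ?q - inner ?w ?p = - (r * (s - s') / 2 + 8 * \<bar>s\<bar> * (1 / 4 + s * s')) * N"
        unfolding N_def norm_sq_2 by (simp add: inner_2 power2_eq_square algebra_simps add_divide_distrib diff_divide_distrib)
      moreover have "0 \<le> r * (s - s') / 2 + 8 * \<bar>s\<bar> * (1 / 4 + s * s')"
      proof -
        have "8 * \<bar>s\<bar> * (1 / 8) \<le> 8 * \<bar>s\<bar> * (1 / 4 + s * s')"
          using ss by (intro mult_left_mono) (auto simp: abs_le_iff)
        moreover have "- \<bar>s\<bar> \<le> r * (s - s') / 2"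
        proof -
          have "\<bar>r * (s - s')\<bar> \<le> 2 * \<bar>s\<bar>" using r assms(1) by (simp add: abs_mult)
          then show ?thesis by linarith
        qed
        ultimately show ?thesis by linarith
      qed
      ultimately show "inner ?w ?q \<le> inner ?w ?p"
        using N by (smt (verit) mult_minus_left mult_nonneg_nonneg)
    qed simp
    then show ?thesis by (simp add: inner_diff_left inner_commute)
  qed
  show ?thesis
    using half[of 1] half[of "-1"] by (simp add: inner_add_right inner_diff_right abs_le_iff)
qed


text \<open>Orthogonal expansion along \<open>u\<close> and \<open>rot u\<close>, multiplied by the
  squared norm of \<open>u\<close> to avoid division.\<close>

lemma decompose_2:
  fixes u v :: "real^2"
  shows "(norm u)\<^sup>2 *\<^sub>R v = inner v u *\<^sub>R u + inner v (rot u) *\<^sub>R rot u"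
  unfolding norm_sq_2 by (simp add: eq_2_iff inner_2 power2_eq_square algebra_simps)

text \<open>For the second edge the base is reversed: the edge then starts at \<open>b\<close>, and
  both slopes change sign, so their product stays negative.\<close>

lemma child_edge_apex:
  assumes "a \<noteq> b" "s * s' < 0" "\<bar>s'\<bar> \<le> \<bar>s\<bar>" "\<bar>s\<bar> \<le> 1 / 50"
    and "(a', b') = (a, apx a b s) \<or> (a', b') = (apx a b s, b)"
  shows "apx a' b' s' \<in> convex hull {a, b, apx a b s}"
    and "apx a' b' (- s') \<notin> convex hull {a, b, apx a b s}"
    and "norm (b' - a') = sqrt (1 / 4 + s\<^sup>2) * norm (b - a)"
proof -
  have r: "apx (apx a b s) b t = apx b (apx b a (- s)) (- t)" for t
    using apx_swap[of b "apx a b s" t] by (simp add: apx_swap)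
  have h: "{a, b, apx a b s} = {b, a, apx b a (- s)}"
    by (auto simp: apx_swap)
  show "apx a' b' s' \<in> convex hull {a, b, apx a b s}"
    using assms child_apex_in_hull[of s s' a b] child_apex_in_hull[of "- s" "- s'" b a]
    by (auto simp: r h)
  show "apx a' b' (- s') \<notin> convex hull {a, b, apx a b s}"
    using assms child_apex_notin_hull[of s s' a b] child_apex_notin_hull[of "- s" "- s'" b a]
    by (auto simp: r h)
  show "norm (b' - a') = sqrt (1 / 4 + s\<^sup>2) * norm (b - a)"
    using assms(5) by (auto simp: norm_apx_left norm_apx_right)
qed

text \<open>\<open>edge_len \<epsilon> n\<close> is the length of the edges of level \<open>n\<close>; \<open>\<bar>slope \<epsilon> n\<bar>\<close> is cap height over
  base length. The sign alternates because a cap inside its parent lies on the side of the directed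
  edge opposite to the side on which the parent lies of its own base.\<close>

definition edge_len :: "real \<Rightarrow> nat \<Rightarrow> real" where
  "edge_len \<epsilon> n = sqrt (1 + 16 * real n * \<epsilon>\<^sup>2) / 2 ^ n"

definition slope :: "real \<Rightarrow> nat \<Rightarrow> real" where
  "slope \<epsilon> n = (- 1) ^ n * (2 * \<epsilon> / sqrt (1 + 16 * real n * \<epsilon>\<^sup>2))"

definition cap :: "real \<Rightarrow> nat \<Rightarrow> nat \<Rightarrow> (real^2) set" where
  "cap \<epsilon> n i = (case cap_data \<epsilon> n i of (a, b, p) \<Rightarrow> convex hull {a, b, p})"

lemma parent_index:
  assumes "i \<in> {1..2 ^ Suc n}"
  shows "(i + 1) div 2 \<in> {1..2 ^ n :: nat}"
  using assms by auto

section \<open>Edge lengths and slopes over the levels\<close>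

context
  fixes \<epsilon> :: real
  assumes eps: "0 < \<epsilon>" "\<epsilon> < 1 / 100"
begin

lemma radicand_pos: "0 < 1 + 16 * real n * \<epsilon>\<^sup>2"
  by (intro add_pos_nonneg) auto

lemma edge_len_pos: "0 < edge_len \<epsilon> n"
  using radicand_pos[of n] by (simp add: edge_len_def)

lemma abs_slope: "\<bar>slope \<epsilon> n\<bar> = 2 * \<epsilon> / sqrt (1 + 16 * real n * \<epsilon>\<^sup>2)"
  using eps radicand_pos[of n] by (simp add: slope_def abs_mult power_abs)

lemma slope_pos: "0 < \<bar>slope \<epsilon> n\<bar>"
  using eps radicand_pos[of n] by (simp add: abs_slope)

lemma slope_alternates: "slope \<epsilon> n * slope \<epsilon> (Suc n) < 0"
proof -
  have "slope \<epsilon> n * slope \<epsilon> (Suc n) = - (\<bar>slope \<epsilon> n\<bar> * \<bar>slope \<epsilon> (Suc n)\<bar>)"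
    unfolding abs_slope unfolding slope_def by (simp flip: power_add mult_2)
  then show ?thesis using slope_pos[of n] slope_pos[of "Suc n"] by simp
qed

lemma slope_antimono: "m \<le> n \<Longrightarrow> \<bar>slope \<epsilon> n\<bar> \<le> \<bar>slope \<epsilon> m\<bar>"
  unfolding abs_slope using eps radicand_pos[of m] radicand_pos[of n]
  by (intro divide_left_mono) (auto intro!: mult_right_mono mult_pos_pos)

lemma slope_le: "\<bar>slope \<epsilon> n\<bar> \<le> 1 / 50"
  using slope_antimono[of 0 n] eps by (simp add: abs_slope[of 0])

lemma slope_edge_len: "\<bar>slope \<epsilon> n\<bar> * edge_len \<epsilon> n = 2 powi (1 - int n) * \<epsilon>"
  using radicand_pos[of n] unfolding abs_slope edge_len_def
  by (simp add: power_int_diff)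

text \<open>In Pythagoras for a new edge, squared lengths at level \<open>n\<close> rescaled by
  \<open>4 ^ n\<close>, each level adds 16 \<epsilon>^2 to the radicand.\<close>

lemma edge_len_Suc: "sqrt (1 / 4 + (slope \<epsilon> n)\<^sup>2) * edge_len \<epsilon> n = edge_len \<epsilon> (Suc n)"
proof -
  have "(slope \<epsilon> n)\<^sup>2 = 4 * \<epsilon>\<^sup>2 / (1 + 16 * real n * \<epsilon>\<^sup>2)"
    using radicand_pos[of n] by (subst power2_abs[symmetric], unfold abs_slope)
      (simp add: power_divide power_mult_distrib)
  then have "1 / 4 + (slope \<epsilon> n)\<^sup>2 = (1 + 16 * real (Suc n) * \<epsilon>\<^sup>2) / (4 * (1 + 16 * real n * \<epsilon>\<^sup>2))"
    using radicand_pos[of n] by (simp add: divide_simps) (simp add: algebra_simps)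
  then have "sqrt (1 / 4 + (slope \<epsilon> n)\<^sup>2)
      = sqrt (1 + 16 * real (Suc n) * \<epsilon>\<^sup>2) / (2 * sqrt (1 + 16 * real n * \<epsilon>\<^sup>2))"
    by (simp only: real_sqrt_divide real_sqrt_mult real_sqrt_four)
  then show ?thesis
    using radicand_pos[of n] by (simp add: edge_len_def)
qed

lemma edge_len_tendsto: "edge_len \<epsilon> \<longlonglongrightarrow> 0"
  unfolding edge_len_def using eps by real_asymp

text \<open>The radicand grows linearly in \<open>n\<close>, so slopes decay like the inverse square
  root of \<open>n\<close>. This is what makes deep caps arbitrarily flat.\<close>

lemma slope_tendsto: "(\<lambda>n. \<bar>slope \<epsilon> n\<bar>) \<longlonglongrightarrow> 0"
  unfolding abs_slope using eps by real_asymp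

section \<open>The recursion in closed form\<close>

lemma cap_data_0: "cap_data \<epsilon> 0 i =
    (vector [0, 0], vector [1, 0], apx (vector [0, 0]) (vector [1, 0]) (slope \<epsilon> 0))"
proof -
  let ?a = "vector [0, 0] :: real^2" and ?b = "vector [1, 0] :: real^2"
  have n: "norm (?b - ?a) = 1"
    by (rule power2_eq_imp_eq) (auto simp: norm_sq_2)
  have ne: "?a \<noteq> ?b" by (simp add: eq_2_iff)
  have s: "slope \<epsilon> 0 = 2 * \<epsilon>" by (simp add: slope_def)
  have "(THE p. cap_apex ?a ?b (2 powi (1 - int 0) * \<epsilon>) p \<and> p $ 2 > 0) = apx ?a ?b (slope \<epsilon> 0)"
    by (rule the_equality) (use eps in \<open>auto simp: cap_apex_iff[OF ne, of "slope \<epsilon> 0"] n s\<close>)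
  then show ?thesis by (simp add: Let_def)
qed

text \<open>Resolves the definite description: of the two candidate apexes the parent contains the
  one with ratio \<open>slope \<epsilon> (Suc n)\<close> and excludes its mirror image.\<close>

lemma cap_data_Suc:
  assumes d: "cap_data \<epsilon> n ((i + 1) div 2) = (a, b, apx a b (slope \<epsilon> n))"
    and l: "norm (b - a) = edge_len \<epsilon> n"
    and e: "(a', b') = (if odd i then (a, apx a b (slope \<epsilon> n)) else (apx a b (slope \<epsilon> n), b))"
  shows "cap_data \<epsilon> (Suc n) i = (a', b', apx a' b' (slope \<epsilon> (Suc n)))"
    and "norm (b' - a') = edge_len \<epsilon> (Suc n)"
    and "cap \<epsilon> (Suc n) i \<subseteq> cap \<epsilon> n ((i + 1) div 2)"
proof -
  let ?p = "apx a b (slope \<epsilon> n)" and ?s = "slope \<epsilon> (Suc n)"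
  let ?H = "convex hull {a, b, ?p}"
  have ab: "a \<noteq> b" using l edge_len_pos[of n] by auto
  have e': "(a', b') = (a, ?p) \<or> (a', b') = (?p, b)" using e by (auto split: if_splits)
  note ch = child_edge_apex[OF ab slope_alternates slope_antimono[of n "Suc n"] slope_le e', simplified]
  show l': "norm (b' - a') = edge_len \<epsilon> (Suc n)"
    using ch(3) l edge_len_Suc by simp
  have ab': "a' \<noteq> b'" using l' edge_len_pos[of "Suc n"] by auto
  have "{a', b', apx a' b' ?s} \<subseteq> ?H"
    using ch(1) e' by (auto intro: hull_inc)
  then have sub: "convex hull {a', b', apx a' b' ?s} \<subseteq> ?H"
    by (simp add: hull_minimal)
  have iff: "cap_apex a' b' (2 powi (1 - int (Suc n)) * \<epsilon>) q \<longleftrightarrow> q = apx a' b' ?s \<or> q = apx a' b' (- ?s)" for q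
  proof -
    have "\<bar>?s\<bar> * norm (b' - a') = 2 powi (1 - int (Suc n)) * \<epsilon>"
      using slope_edge_len[of "Suc n"] l' by simp
    then show ?thesis
      by (subst cap_apex_iff[OF ab', of "\<bar>?s\<bar>"]) (auto simp: abs_if)
  qed
  have "(THE q. cap_apex a' b' (2 powi (1 - int (Suc n)) * \<epsilon>) q \<and>
      convex hull {a', b', q} \<subseteq> ?H) = apx a' b' ?s"
  proof (rule the_equality)
    show "q = apx a' b' ?s" if "cap_apex a' b' (2 powi (1 - int (Suc n)) * \<epsilon>) q \<and>
      convex hull {a', b', q} \<subseteq> ?H" for q
    proof -
      \<comment> \<open>Containment of the whole cap forces its apex into the parent, which rules
        out the wrong sign.\<close>
      have "q \<in> convex hull {a', b', q}" by (rule hull_inc) simp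
      then have "q \<in> ?H" using that by auto
      then show ?thesis using that ch(2) iff by auto
    qed
  qed (use sub iff in auto)
  then show c: "cap_data \<epsilon> (Suc n) i = (a', b', apx a' b' ?s)"
    using e by (simp add: d[simplified] Let_def split: if_splits del: of_nat_Suc)
  show "cap \<epsilon> (Suc n) i \<subseteq> cap \<epsilon> n ((i + 1) div 2)"
    unfolding cap_def c d using sub by simp
qed

text \<open>Induction along parents; the index is arbitrary, since level 0 ignores it and every
  later index has a parent.\<close>

lemma cap_data_apx:
  obtains a b where "cap_data \<epsilon> n i = (a, b, apx a b (slope \<epsilon> n))" "norm (b - a) = edge_len \<epsilon> n"
proof -
  have "\<exists>a b. cap_data \<epsilon> n i = (a, b, apx a b (slope \<epsilon> n)) \<and> norm (b - a) = edge_len \<epsilon> n"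
  proof (induction n arbitrary: i)
    case 0
    have "norm (vector [1, 0] - vector [0, 0] :: real^2) = 1"
      by (rule power2_eq_imp_eq) (auto simp: norm_sq_2)
    then show ?case by (auto simp: cap_data_0 edge_len_def simp del: cap_data.simps)
  next
    case (Suc n)
    then obtain a b where *: "cap_data \<epsilon> n ((i + 1) div 2) = (a, b, apx a b (slope \<epsilon> n))"
      "norm (b - a) = edge_len \<epsilon> n" by blast
    obtain a' b' where "(a', b') = (if odd i then (a, apx a b (slope \<epsilon> n)) else (apx a b (slope \<epsilon> n), b))"
      by (metis)
    then show ?case using cap_data_Suc(1,2)[OF *] by blast
  qed
  then show ?thesis using that by blast
qed

lemma cap_Suc_subset: "cap \<epsilon> (Suc n) i \<subseteq> cap \<epsilon> n ((i + 1) div 2)"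
proof -
  obtain a b where *: "cap_data \<epsilon> n ((i + 1) div 2) = (a, b, apx a b (slope \<epsilon> n))"
      "norm (b - a) = edge_len \<epsilon> n" by (rule cap_data_apx)
  obtain a' b' where "(a', b') = (if odd i then (a, apx a b (slope \<epsilon> n)) else (apx a b (slope \<epsilon> n), b))"
    by (metis)
  then show ?thesis using cap_data_Suc(3)[OF *] by blast
qed

text \<open>For odd indices \<open>child_cone\<close> applies directly; for even ones it is applied
  to the reversed base, which turns the cone around.\<close>

lemma cap_child_cone:
  assumes d: "cap_data \<epsilon> n k = (a, b, p)"
    and i: "(i + 1) div 2 = k" and x: "x \<in> cap \<epsilon> (Suc n) i"
  shows "odd i \<Longrightarrow> \<bar>inner (x - p) (rot (b - a))\<bar> \<le> - (8 * \<bar>slope \<epsilon> n\<bar>) * inner (x - p) (b - a)"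
    and "even i \<Longrightarrow> \<bar>inner (x - p) (rot (b - a))\<bar> \<le> 8 * \<bar>slope \<epsilon> n\<bar> * inner (x - p) (b - a)"
proof -
  let ?s = "slope \<epsilon> n" and ?s' = "slope \<epsilon> (Suc n)"
  have p: "p = apx a b ?s" and l: "norm (b - a) = edge_len \<epsilon> n"
    using cap_data_apx[of n k] d by fastforce+
  note c = cap_data_Suc(1)[OF d[unfolded p, folded i] l]
  note b = slope_antimono[of n "Suc n", simplified] slope_le[of n]
  show "\<bar>inner (x - p) (rot (b - a))\<bar> \<le> - (8 * \<bar>?s\<bar>) * inner (x - p) (b - a)" if "odd i"
    unfolding p
  proof (rule child_cone[OF b])
    show "x \<in> convex hull {a, apx a b ?s, apx a (apx a b ?s) ?s'}"
      using x that c[of a "apx a b ?s"] by (simp add: cap_def)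
  qed
  show "\<bar>inner (x - p) (rot (b - a))\<bar> \<le> 8 * \<bar>?s\<bar> * inner (x - p) (b - a)" if "even i"
  proof -
    have "\<bar>inner (x - apx b a (- ?s)) (rot (a - b))\<bar>
        \<le> - (8 * \<bar>- ?s\<bar>) * inner (x - apx b a (- ?s)) (a - b)"
    proof (rule child_cone[where s' = "- ?s'"])
      have "{b, apx b a (- ?s), apx b (apx b a (- ?s)) (- ?s')}
          = {apx a b ?s, b, apx (apx a b ?s) b ?s'}"
        by (auto simp: apx_swap)
      then show "x \<in> convex hull {b, apx b a (- ?s), apx b (apx b a (- ?s)) (- ?s')}"
        using x that c[of "apx a b ?s" b] by (simp add: cap_def)
    qed (use b in auto)
    moreover have "rot (a - b) = - rot (b - a)" "a - b = - (b - a)" by (simp_all add: eq_2_iff)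
    ultimately show ?thesis unfolding p by (simp only: apx_swap inner_minus_right abs_minus_cancel)
  qed
qed

section \<open>Covering by caps, and uniqueness of the cap containing a point\<close>

lemma compact_cap: "compact (cap \<epsilon> n i)"
  by (auto simp: cap_def finite_imp_compact_convex_hull split: prod.splits)

lemma dist_cap_le:
  assumes "x \<in> cap \<epsilon> n i" "y \<in> cap \<epsilon> n i"
  shows "dist x y \<le> 2 * edge_len \<epsilon> n"
proof -
  obtain a b where d: "cap_data \<epsilon> n i = (a, b, apx a b (slope \<epsilon> n))"
      and l: "norm (b - a) = edge_len \<epsilon> n" by (rule cap_data_apx)
  \<comment> \<open>The slope bound keeps the apex no farther from \<open>a\<close> than
    \<open>b\<close> is, so one ball about \<open>a\<close> holds all three vertices.\<close>
  have s: "sqrt (1 / 4 + (slope \<epsilon> n)\<^sup>2) \<le> 1"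
    using power_mono[OF slope_le[of n] abs_ge_zero, of 2] by (simp add: power_divide)
  have "norm (apx a b (slope \<epsilon> n) - a) \<le> norm (b - a)"
    unfolding norm_apx_left using s by (intro mult_left_le_one_le) auto
  then have "{a, b, apx a b (slope \<epsilon> n)} \<subseteq> cball a (edge_len \<epsilon> n)"
    using l edge_len_pos[of n] by (auto simp: dist_norm norm_minus_commute)
  then have "cap \<epsilon> n i \<subseteq> cball a (edge_len \<epsilon> n)"
    unfolding cap_def d by (simp add: hull_minimal)
  then have "dist a x \<le> edge_len \<epsilon> n" "dist a y \<le> edge_len \<epsilon> n" using assms by auto
  then show ?thesis using dist_triangle3[of x y a] by simp
qed

lemma seg_subset_cap: "seg \<epsilon> n i \<subseteq> cap \<epsilon> n i"
proof -
  have "convex hull {a, b} \<subseteq> convex hull {a, b, p}" for a b p :: "real^2"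
    by (rule hull_mono) auto
  then show ?thesis
    unfolding seg_def cap_def segment_convex_hull by (simp split: prod.splits)
qed

lemma polygon_curve_subset_caps:
  assumes "n \<le> m"
  shows "polygon_curve \<epsilon> m \<subseteq> (\<Union>i\<in>{1..2 ^ n}. cap \<epsilon> n i)"
proof -
  have "(\<Union>i\<in>{1..2 ^ m}. cap \<epsilon> m i) \<subseteq> (\<Union>i\<in>{1..2 ^ n}. cap \<epsilon> n i)"
    using assms
  proof (induction m rule: dec_induct)
    case (step m)
    have "(\<Union>i\<in>{1..2 ^ Suc m}. cap \<epsilon> (Suc m) i) \<subseteq> (\<Union>i\<in>{1..2 ^ m}. cap \<epsilon> m i)"
      using cap_Suc_subset parent_index by (intro UN_least) blast
    then show ?case using step.IH by blast
  qed simp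
  then show ?thesis
    using seg_subset_cap unfolding polygon_curve_def by blast
qed

text \<open>The caps of level \<open>n\<close> contain all curves from level \<open>n\<close> on.
  Together with the finitely many earlier curves they form a closed set, which therefore contains
  the closure; the earlier curves are removed in \<open>A_eps\<close>.\<close>

lemma A_eps_subset_caps: "A_eps \<epsilon> \<subseteq> (\<Union>i\<in>{1..2 ^ n}. cap \<epsilon> n i)"
proof -
  let ?U = "\<Union>i\<in>{1..2 ^ n}. cap \<epsilon> n i" and ?P = "\<Union>m\<in>{1..<n}. polygon_curve \<epsilon> m"
  have "closed (seg \<epsilon> m i)" for m i
    by (simp add: seg_def split: prod.splits)
  then have "closed (?U \<union> ?P)"
    unfolding polygon_curve_def
    by (intro closed_Un closed_UN) (auto intro: compact_imp_closed compact_cap)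
  moreover have "(\<Union>m\<in>{1..}. polygon_curve \<epsilon> m) \<subseteq> ?U \<union> ?P"
  proof (intro UN_least)
    fix m :: nat assume "m \<in> {1..}"
    then show "polygon_curve \<epsilon> m \<subseteq> ?U \<union> ?P"
      using polygon_curve_subset_caps[of n m] by (cases "n \<le> m") auto
  qed
  ultimately have "closure (\<Union>m\<in>{1..}. polygon_curve \<epsilon> m) \<subseteq> ?U \<union> ?P"
    by (rule closure_minimal[rotated])
  then show ?thesis unfolding A_eps_def by auto
qed

text \<open>The opposite cones of two siblings meet only in the parent apex, which is an endpoint of
  an edge of level \<open>Suc n\<close> and hence not in \<open>A_eps\<close>.\<close>

lemma siblings_disjoint:
  assumes z: "z \<in> A_eps \<epsilon>" "z \<in> cap \<epsilon> (Suc n) i" "z \<in> cap \<epsilon> (Suc n) j"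
    and ij: "odd i" "even j" "(i + 1) div 2 = (j + 1) div 2" "i \<in> {1..2 ^ Suc n}"
  shows False
proof -
  obtain a b where d: "cap_data \<epsilon> n ((i + 1) div 2) = (a, b, apx a b (slope \<epsilon> n))"
      and l: "norm (b - a) = edge_len \<epsilon> n" by (rule cap_data_apx)
  let ?p = "apx a b (slope \<epsilon> n)"
  define u where "u = b - a"
  have u: "u \<noteq> 0" using l edge_len_pos[of n] by (auto simp: u_def)
  have c: "\<bar>inner (z - ?p) (rot u)\<bar> \<le> - (8 * \<bar>slope \<epsilon> n\<bar>) * inner (z - ?p) u"
          "\<bar>inner (z - ?p) (rot u)\<bar> \<le> 8 * \<bar>slope \<epsilon> n\<bar> * inner (z - ?p) u"
    using cap_child_cone[OF d] z ij by (simp_all add: u_def)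
  \<comment> \<open>The two bounds on the same absolute value are negatives of each other.\<close>
  have "8 * \<bar>slope \<epsilon> n\<bar> * inner (z - ?p) u = 0" "inner (z - ?p) (rot u) = 0"
    using c by linarith+
  then have "inner (z - ?p) u = 0" "inner (z - ?p) (rot u) = 0"
    using slope_pos[of n] by auto
  then have "z = ?p" using decompose_2[of u "z - ?p"] u by simp
  moreover have "?p \<in> seg \<epsilon> (Suc n) i"
    using cap_data_Suc(1)[OF d l, of a ?p] ij by (simp add: seg_def)
  ultimately have "z \<in> polygon_curve \<epsilon> (Suc n)"
    unfolding polygon_curve_def by (intro UN_I[OF ij(4)]) simp
  then have "z \<in> (\<Union>n\<in>{1..}. polygon_curve \<epsilon> n)"
    by (rule UN_I[rotated]) simp
  then show False using z(1) by (simp add: A_eps_def)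
qed

text \<open>By induction the parents agree, and siblings of different parity share no point of
  \<open>A_eps\<close>.\<close>

lemma cap_index_unique:
  assumes "z \<in> A_eps \<epsilon>" "z \<in> cap \<epsilon> n i" "z \<in> cap \<epsilon> n j" "i \<in> {1..2 ^ n}" "j \<in> {1..2 ^ n}"
  shows "i = j"
  using assms
proof (induction n arbitrary: i j)
  case (Suc n)
  have p: "(i + 1) div 2 = (j + 1) div 2"
    by (rule Suc.IH[OF Suc.prems(1) subsetD[OF cap_Suc_subset Suc.prems(2)]
          subsetD[OF cap_Suc_subset Suc.prems(3)] parent_index[OF Suc.prems(4)]
          parent_index[OF Suc.prems(5)]])
  have "odd i \<longleftrightarrow> odd j"
    using siblings_disjoint[OF Suc.prems(1-3) _ _ p Suc.prems(4)]
      siblings_disjoint[OF Suc.prems(1,3,2) _ _ p[symmetric] Suc.prems(5)] by blast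
  then show ?case using p by presburger
qed auto

section \<open>The approximating line\<close>

text \<open>A set meeting both children within a ball of radius \<rho> has points on both sides of
  the apex along the base direction. This bounds the coordinate along the base, and the cones then
  bound the distance to the line through the apex parallel to the base.\<close>

lemma flat_near_apex:
  assumes S: "S \<subseteq> ball x \<rho>" "S \<subseteq> cap \<epsilon> (Suc n) i \<union> cap \<epsilon> (Suc n) j"
    and v: "v \<in> S" "v \<in> cap \<epsilon> (Suc n) i" and w: "w \<in> S" "w \<in> cap \<epsilon> (Suc n) j"
    and ij: "odd i" "even j" "(i + 1) div 2 = (j + 1) div 2"
    and \<delta>: "16 * \<bar>slope \<epsilon> n\<bar> \<le> \<delta>"
  shows "\<exists>L. affine L \<and> aff_dim L = 1 \<and> S \<subseteq> open_nbhd L (\<delta> * \<rho>)"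
proof -
  obtain a b where d: "cap_data \<epsilon> n ((i + 1) div 2) = (a, b, apx a b (slope \<epsilon> n))"
      and l: "norm (b - a) = edge_len \<epsilon> n" by (rule cap_data_apx)
  define p where "p = apx a b (slope \<epsilon> n)"
  define s where "s = \<bar>slope \<epsilon> n\<bar>"
  define u where "u = b - a"
  have s: "0 < s" using slope_pos by (simp add: s_def)
  have u: "0 < norm u" using l edge_len_pos[of n] by (auto simp: u_def)
  have ci: "\<bar>inner (z - p) (rot u)\<bar> \<le> - (8 * s) * inner (z - p) u" if "z \<in> cap \<epsilon> (Suc n) i" for z
    using cap_child_cone(1)[OF d] that ij by (simp add: u_def p_def s_def)
  have cj: "\<bar>inner (z - p) (rot u)\<bar> \<le> 8 * s * inner (z - p) u" if "z \<in> cap \<epsilon> (Suc n) j" for z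
    using cap_child_cone(2)[OF d] that ij by (simp add: u_def p_def s_def)
  have neg: "inner (z - p) u \<le> 0" if "z \<in> cap \<epsilon> (Suc n) i" for z
    using ci[OF that] s by (smt (verit) mult_pos_pos mult_minus_left)
  have pos: "0 \<le> inner (z - p) u" if "z \<in> cap \<epsilon> (Suc n) j" for z
    using cj[OF that] s by (smt (verit) mult_pos_neg)
  have close: "\<bar>inner (y - z) u\<bar> < 2 * \<rho> * norm u" if "y \<in> S" "z \<in> S" for y z
  proof -
    have "dist x y < \<rho>" "dist x z < \<rho>" using that S(1) by auto
    then have "norm (y - z) < 2 * \<rho>"
      using dist_triangle3[of y z x] by (simp flip: dist_norm)
    then have "norm (y - z) * norm u < 2 * \<rho> * norm u" using u by simp
    then show ?thesis using Cauchy_Schwarz_ineq2[of "y - z" u] by linarith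
  qed
  define L where "L = affine hull {p, p + u}"
  have "z \<in> open_nbhd L (\<delta> * \<rho>)" if z: "z \<in> S" for z
  proof -
    define t where "t = inner (z - p) u / (norm u)\<^sup>2"
    define q where "q = inner (z - p) (rot u) / (norm u)\<^sup>2"
    have "\<bar>inner (z - p) (rot u)\<bar> < 8 * s * (2 * \<rho> * norm u)"
    proof -
      have "\<bar>inner (z - p) (rot u)\<bar> \<le> 8 * s * \<bar>inner (z - p) u\<bar>"
      proof (cases "z \<in> cap \<epsilon> (Suc n) i")
        case True
        then show ?thesis using ci[of z] neg[of z] by simp
      next
        case False
        then have "z \<in> cap \<epsilon> (Suc n) j" using S(2) z by blast
        then show ?thesis using cj[of z] pos[of z] by simp
      qed
      \<comment> \<open>Compare \<open>z\<close> with the given point of the other child: the two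
        coordinates have opposite signs, so that of \<open>z\<close> is at most their difference in
        modulus.\<close>
      moreover have "\<bar>inner (z - p) u\<bar> < 2 * \<rho> * norm u"
      proof -
        have e: "inner (z - y) u = inner (z - p) u - inner (y - p) u" for y
          by (simp flip: inner_diff_left)
        note c = close[OF z v(1), unfolded e[of v]] close[OF z w(1), unfolded e[of w]]
        show ?thesis
        proof (cases "z \<in> cap \<epsilon> (Suc n) i")
          case True
          then show ?thesis using c(2) neg[of z] pos[OF w(2)] by linarith
        next
          case False
          then have "z \<in> cap \<epsilon> (Suc n) j" using S(2) z by blast
          then show ?thesis using c(1) pos[of z] neg[OF v(2)] by linarith
        qed
      qed
      ultimately show ?thesis using s by (smt (verit) mult_strict_left_mono)
    qed
    \<comment> \<open>The left side is the distance from \<open>z\<close> to its foot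
      \<open>p + t *\<^sub>R u\<close> on \<open>L\<close>; 16 is the opening factor 8 times the
      factor 2 from the diameter of the ball.\<close>
    then have "\<bar>q\<bar> * norm u < 16 * s * \<rho>"
      using u by (simp add: q_def abs_mult power2_eq_square field_simps)
    moreover have "z - p = t *\<^sub>R u + q *\<^sub>R rot u"
    proof -
      have "(1 / (norm u)\<^sup>2) *\<^sub>R ((norm u)\<^sup>2 *\<^sub>R (z - p)) = t *\<^sub>R u + q *\<^sub>R rot u"
        unfolding decompose_2 by (simp add: t_def q_def scaleR_add_right)
      then show ?thesis using u by simp
    qed
    then have "norm (z - (p + t *\<^sub>R u)) = \<bar>q\<bar> * norm u"
      by (simp add: algebra_simps flip: diff_diff_eq)
    moreover have "16 * s * \<rho> \<le> \<delta> * \<rho>"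
    proof -
      have "0 < \<rho>" using z S(1) by (metis ball_empty empty_iff not_less subset_eq)
      then show ?thesis using \<delta> by (simp add: s_def)
    qed
    moreover have "p + t *\<^sub>R u \<in> L"
      unfolding L_def affine_hull_2
      by (intro CollectI exI[of _ "1 - t"] exI[of _ t]) (simp add: algebra_simps)
    ultimately show ?thesis unfolding open_nbhd_def by force
  qed
  moreover have "aff_dim L = 1"
    using u by (simp add: L_def aff_dim_affine_hull aff_dim_2)
  ultimately show ?thesis
    by (intro exI[of _ L]) (auto simp: L_def affine_affine_hull)
qed

lemma fine_weak_approx_A_eps: "fine_weak_approx 1 (A_eps \<epsilon>)"
  unfolding fine_weak_approx_def
proof (intro allI impI ballI)
  fix \<delta> :: real and y
  assume \<delta>: "0 < \<delta>" and y: "y \<in> A_eps \<epsilon>"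
  \<comment> \<open>The level \<open>N\<close> depends on \<delta> alone; 16 matches the hypothesis
    of \<open>flat_near_apex\<close>.\<close>
  have "eventually (\<lambda>n. \<bar>slope \<epsilon> n\<bar> < \<delta> / 16) sequentially"
    using order_tendstoD(2)[OF slope_tendsto, of "\<delta> / 16"] \<delta> by simp
  then obtain N where N: "\<bar>slope \<epsilon> N\<bar> < \<delta> / 16"
    by (auto simp: eventually_sequentially)
  obtain k where k: "k \<in> {1..2 ^ N}" "y \<in> cap \<epsilon> N k"
    using A_eps_subset_caps[of N] y by auto
  let ?C = "\<Union>i\<in>{1..2 ^ N} - {k}. cap \<epsilon> N i"
  \<comment> \<open>The finitely many other caps of level \<open>N\<close> are closed and miss
    \<open>y\<close>, so a whole ball about \<open>y\<close> avoids them.\<close>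
  have "closed ?C" by (intro closed_UN) (auto intro: compact_imp_closed compact_cap)
  then have "open (- ?C)" by (rule open_Compl)
  moreover have "y \<in> - ?C" using cap_index_unique[OF y k(2) _ k(1)] by blast
  ultimately obtain r where r: "0 < r" "ball y r \<subseteq> - ?C"
    by (rule openE)
  show "\<exists>\<rho>y>0. \<forall>\<rho>\<in>{0<..\<rho>y}. \<forall>x\<in>ball y \<rho>y. \<exists>L. affine L \<and> aff_dim L = int 1 \<and>
      ball x \<rho> \<inter> A_eps \<epsilon> \<subseteq> open_nbhd L (\<delta> * \<rho>)"
  \<comment> \<open>Half of \<open>r\<close> for the center and half for the radius keep
    \<open>ball x \<rho>\<close> inside \<open>ball y r\<close>.\<close>
  proof (intro exI[of _ "r / 2"] conjI ballI)
    fix \<rho> x assume \<rho>: "\<rho> \<in> {0<..r / 2}" and x: "x \<in> ball y (r / 2)"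
    define S where "S = ball x \<rho> \<inter> A_eps \<epsilon>"
    have SN: "S \<subseteq> cap \<epsilon> N k"
    proof
      fix z assume z: "z \<in> S"
      then have "z \<in> ball y r"
        using x \<rho> dist_triangle[of y z x] by (auto simp: S_def)
      then show "z \<in> cap \<epsilon> N k"
        using r(2) z A_eps_subset_caps[of N] unfolding S_def by blast
    qed
    show "\<exists>L. affine L \<and> aff_dim L = int 1 \<and> ball x \<rho> \<inter> A_eps \<epsilon> \<subseteq> open_nbhd L (\<delta> * \<rho>)"
    proof (cases "\<exists>v\<in>S. \<exists>w\<in>S. v \<noteq> w")
      case False
      \<comment> \<open>With at most one point, a line through it in any direction will do.\<close>
      obtain c where c: "S \<subseteq> {c}" using False by blast
      let ?L = "affine hull {c, c + axis 1 1 :: real^2}"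
      have "c \<in> ?L" by (rule hull_inc) simp
      then have "S \<subseteq> open_nbhd ?L (\<delta> * \<rho>)"
        using c \<delta> \<rho> by (force simp: open_nbhd_def)
      moreover have "aff_dim ?L = 1"
        by (simp add: aff_dim_affine_hull aff_dim_2 axis_eq_0_iff)
      ultimately show ?thesis
        unfolding S_def by (intro exI[of _ ?L]) (simp add: affine_affine_hull)
    next
      case True
      then obtain v w where vw: "v \<in> S" "w \<in> S" "v \<noteq> w" by blast
      define fits where "fits n \<longleftrightarrow> (\<exists>i\<in>{1..2 ^ n}. S \<subseteq> cap \<epsilon> n i)" for n
      have "eventually (\<lambda>n. edge_len \<epsilon> n < dist v w / 2) sequentially"
        using order_tendstoD(2)[OF edge_len_tendsto, of "dist v w / 2"] vw by simp
      then obtain M where M: "\<And>n. M \<le> n \<Longrightarrow> edge_len \<epsilon> n < dist v w / 2"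
        by (auto simp: eventually_sequentially)
      \<comment> \<open>Cap diameters tend to 0, so two distinct points of \<open>S\<close> cannot
        share a cap at all levels; hence there is a last level that fits.\<close>
      have "n \<le> M" if fits: "fits n" for n
      proof (rule ccontr)
        assume "\<not> n \<le> M"
        moreover obtain i where "S \<subseteq> cap \<epsilon> n i" using fits unfolding fits_def by blast
        then have "dist v w \<le> 2 * edge_len \<epsilon> n" using vw by (intro dist_cap_le) auto
        ultimately show False using M[of n] by simp
      qed
      moreover have "fits N" using SN k by (auto simp: fits_def)
      ultimately obtain n where n: "fits n" "\<And>m. fits m \<Longrightarrow> m \<le> n"
        by (metis GreatestI_nat Greatest_le_nat)
      obtain m where m: "m \<in> {1..2 ^ n}" "S \<subseteq> cap \<epsilon> n m" using n(1) by (auto simp: fits_def)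
      have "N \<le> n" using n(2) \<open>fits N\<close> by blast
      \<comment> \<open>The two children of \<open>m\<close>; the subtraction on naturals is exact
        because \<open>m\<close> is at least 1.\<close>
      let ?i = "2 * m - 1" and ?j = "2 * m"
      have rng: "?i \<in> {1..2 ^ Suc n}" "?j \<in> {1..2 ^ Suc n}" and par: "odd ?i" "(?i + 1) div 2 = m"
        using m(1) by auto
      have S2: "S \<subseteq> cap \<epsilon> (Suc n) ?i \<union> cap \<epsilon> (Suc n) ?j"
      proof
        fix z assume z: "z \<in> S"
        then have zA: "z \<in> A_eps \<epsilon>" by (simp add: S_def)
        then obtain i where i: "i \<in> {1..2 ^ Suc n}" "z \<in> cap \<epsilon> (Suc n) i"
          using A_eps_subset_caps[of "Suc n"] by blast
        \<comment> \<open>The parent of the cap of \<open>z\<close> also contains \<open>z\<close>,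
          so uniqueness at level \<open>n\<close> identifies it with \<open>m\<close>.\<close>
        have "(i + 1) div 2 = m"
          using cap_index_unique[OF zA _ _ parent_index[OF i(1)] m(1)] i(2) cap_Suc_subset m(2) z
          by blast
        then have "i = ?i \<or> i = ?j" using i(1) by auto
        then show "z \<in> cap \<epsilon> (Suc n) ?i \<union> cap \<epsilon> (Suc n) ?j" using i(2) by auto
      qed
      have nf: "\<not> S \<subseteq> cap \<epsilon> (Suc n) i" if "i \<in> {1..2 ^ Suc n}" for i
      proof
        assume "S \<subseteq> cap \<epsilon> (Suc n) i"
        then have "fits (Suc n)" using that unfolding fits_def by (intro bexI)
        then show False using n(2)[of "Suc n"] by simp
      qed
      \<comment> \<open>Neither child alone covers \<open>S\<close>, by maximality of
        \<open>n\<close>, so \<open>S\<close> meets both.\<close>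
      obtain v' w' where "v' \<in> S" "v' \<in> cap \<epsilon> (Suc n) ?i" "w' \<in> S" "w' \<in> cap \<epsilon> (Suc n) ?j"
        using nf[OF rng(1)] nf[OF rng(2)] S2 by blast
      moreover have "16 * \<bar>slope \<epsilon> n\<bar> \<le> \<delta>"
        using slope_antimono[OF \<open>N \<le> n\<close>] N by simp
      ultimately have "\<exists>L. affine L \<and> aff_dim L = 1 \<and> S \<subseteq> open_nbhd L (\<delta> * \<rho>)"
        using S2 par by (intro flat_near_apex[of S x \<rho> n ?i ?j]) (auto simp: S_def)
      then show ?thesis by (simp add: S_def)
    qed
  qed (use r in auto)
qed

end

text \<open>The same radii and lines serve: there are fewer base points, and less has to be
  covered.\<close>

lemma fine_weak_approx_subset:
  assumes "fine_weak_approx j A" "B \<subseteq> A"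
  shows "fine_weak_approx j B"
  using assms unfolding fine_weak_approx_def by (meson Int_mono order_refl order_trans subsetD)

theorem lemma5p4:
  fixes \<epsilon> :: real
  assumes "0 < \<epsilon>" and "\<epsilon> < 1 / 100"
  shows "fine_weak_approx 1 (A_eps \<epsilon>) \<and> fine_weak_approx 1 (A_cal_eps \<epsilon>)"
proof
  show "fine_weak_approx 1 (A_eps \<epsilon>)"
    using assms by (rule fine_weak_approx_A_eps)
  then show "fine_weak_approx 1 (A_cal_eps \<epsilon>)"
    by (rule fine_weak_approx_subset) (auto simp: A_cal_eps_def)
qed

end
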